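(* Any protocol that decides the realizability problem for the class of half-planes in $\mathbb R^2$ must have sample complexity at least $\tilde\Omega(\log n)$ for samples of size $n$.
   Context: Half-planes in $\mathbb R^2$: functions $x\mapsto+1$ if $\langle w,x\rangle\ge b$ and $-1$ otherwise ($w\in\mathbb R^2$, $b\in\mathbb R$). Communication model: examples are pairs $(x,y)\in\mathbb R^2\times\{\pm1\}$; a sample is a finite sequence of examples. Alice receives sample $S_a$, Bob receives $S_b$, joint sample $S=(S_a,S_b)$ of size $n$, arbitrarily split. A deterministic protocol proceeds by messages, each either a single example from the sender's own input sample or a bit, depending only on the sender's input and previous messages; the output is determined by the messages; each example or bit costs one unit; sample complexity is the maximum number of units transmitted on inputs of size $n$. The realizability problem: decide whether some half-plane $h$ satisfies $h(x)=y$ for all $(x,y)\in S$. $\tilde\Omega$ hides logarithmic factors. *)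

theory Defs
  imports Complex_Main "HOL-Library.Extended_Real"
begin

text \<open>Points of the plane are pairs of reals; labels +1 / -1 are encoded as True / False.\<close>

type_synonym point = "real \<times> real"
type_synonym example = "point \<times> bool"
type_synonym sample = "example list"

definition halfplane :: "point \<Rightarrow> real \<Rightarrow> point \<Rightarrow> bool" where
  "halfplane w b x \<longleftrightarrow> fst w * fst x + snd w * snd x \<ge> b"

definition realizable :: "sample \<Rightarrow> bool" where
  "realizable S \<longleftrightarrow> (\<exists>w b. \<forall>(x, y) \<in> set S. halfplane w b x = y)"

datatype msg = Ex example | Bit bool

text \<open>A deterministic protocol: whose turn it is (or halting, None) and the output are
  functions of the transcript; each party's message depends on its own input sample and the
  transcript so far.  Some True means Alice speaks, Some False means Bob speaks.\<close>
record protocol =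
  turn :: "msg list \<Rightarrow> bool option"
  alice :: "sample \<Rightarrow> msg list \<Rightarrow> msg"
  bob :: "sample \<Rightarrow> msg list \<Rightarrow> msg"
  out :: "msg list \<Rightarrow> bool"

fun run :: "protocol \<Rightarrow> sample \<Rightarrow> sample \<Rightarrow> nat \<Rightarrow> msg list" where
  "run P Sa Sb 0 = []"
| "run P Sa Sb (Suc k) =
     (let h = run P Sa Sb k in
      case turn P h of
        None \<Rightarrow> h
      | Some True \<Rightarrow> h @ [alice P Sa h]
      | Some False \<Rightarrow> h @ [bob P Sb h])"

definition halts :: "protocol \<Rightarrow> sample \<Rightarrow> sample \<Rightarrow> bool" where
  "halts P Sa Sb \<longleftrightarrow> (\<exists>k. turn P (run P Sa Sb k) = None)"

text \<open>The complete transcript (meaningful when the protocol halts).\<close>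
definition transcript :: "protocol \<Rightarrow> sample \<Rightarrow> sample \<Rightarrow> msg list" where
  "transcript P Sa Sb = run P Sa Sb (LEAST k. turn P (run P Sa Sb k) = None)"

definition valid_run :: "protocol \<Rightarrow> sample \<Rightarrow> sample \<Rightarrow> bool" where
  "valid_run P Sa Sb \<longleftrightarrow>
     (\<forall>k e. (turn P (run P Sa Sb k) = Some True \<and> alice P Sa (run P Sa Sb k) = Ex e \<longrightarrow> e \<in> set Sa)
          \<and> (turn P (run P Sa Sb k) = Some False \<and> bob P Sb (run P Sa Sb k) = Ex e \<longrightarrow> e \<in> set Sb))"

definition decides_realizability :: "protocol \<Rightarrow> bool" where
  "decides_realizability P \<longleftrightarrow>
     (\<forall>Sa Sb. halts P Sa Sb \<and> valid_run P Sa Sb \<and>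
        out P (transcript P Sa Sb) = realizable (Sa @ Sb))"

definition sample_complexity :: "protocol \<Rightarrow> nat \<Rightarrow> enat" where
  "sample_complexity P n =
     (SUP p \<in> {(Sa, Sb). length Sa + length Sb = n}. enat (length (transcript P (fst p) (snd p))))"

end

theory Submission
  imports Defs "HOL-Library.FuncSet" "HOL-Real_Asymp.Real_Asymp"
begin

text \<open>
  The lower bound comes from pointer jumping on a tree of degree \<open>d = \<Theta>(log n)\<close> and depth
  \<open>\<Theta>(log n / log log n)\<close>. One player holds an array of \<open>d\<close> subinstances, the other a pointer into the
  array and their half of the subinstance pointed to; on the next level the roles are exchanged. There
  are only \<open>O(n)\<close> possible messages, so a message cannot convey much about most of the \<open>d\<close>
  array entries: if \<open>d\<close> is large compared to \<open>log n\<close>, then after each message one can pass to a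
  subinstance a bounded number of levels below on which both sets of inputs are still dense.

  In the plane, the subinstances are tiny, flattened, upside-down affine copies placed at the points
  \<open>(i, i\<^sup>2)\<close> of a parabola. A line separating the copy at \<open>i\<close> is almost tangent to the parabola at \<open>i\<close>,
  hence clears all the other copies, which therefore do not influence realizability.
\<close>

section \<open>Rectangle partitions by short protocols\<close>

text \<open>A protocol tree of depth exactly \<open>T\<close> with monochromatic leaves. Each fibre
  gets its own subtree, so speakers and message functions may depend on the history. Of the messages
  only their number per round is recorded, which is all that the counting needs.\<close>

fun solv :: "nat \<Rightarrow> nat \<Rightarrow> 'a set \<Rightarrow> 'b set \<Rightarrow> ('a \<Rightarrow> 'b \<Rightarrow> bool) \<Rightarrow> bool" where
  "solv M 0 A B f \<longleftrightarrow> (\<exists>v. \<forall>a\<in>A. \<forall>b\<in>B. f a b = v)"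
| "solv M (Suc T) A B f \<longleftrightarrow>
     (\<exists>g :: 'a \<Rightarrow> msg. finite (g ` A) \<and> card (g ` A) \<le> M \<and> (\<forall>m. solv M T {a \<in> A. g a = m} B f)) \<or>
     (\<exists>g :: 'b \<Rightarrow> msg. finite (g ` B) \<and> card (g ` B) \<le> M \<and> (\<forall>m. solv M T A {b \<in> B. g b = m} f))"

lemma solv_reindex:
  assumes "solv M T A B f" "\<sigma> ` A' \<subseteq> A" "\<tau> ` B' \<subseteq> B"
    and "\<And>a b. a \<in> A' \<Longrightarrow> b \<in> B' \<Longrightarrow> f' a b = f (\<sigma> a) (\<tau> b)"
  shows "solv M T A' B' f'"
  using assms
proof (induction T arbitrary: A B A' B')
  case 0
  then obtain v where "\<forall>a\<in>A. \<forall>b\<in>B. f a b = v" by auto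
  then have "\<forall>a\<in>A'. \<forall>b\<in>B'. f' a b = v" using 0 by (auto simp: image_subset_iff)
  then show ?case by auto
next
  case (Suc T)
  from Suc.prems(1) consider
    (a) g :: "'a \<Rightarrow> msg" where "finite (g ` A)" "card (g ` A) \<le> M" "\<forall>m. solv M T {a \<in> A. g a = m} B f"
  | (b) g :: "'b \<Rightarrow> msg" where "finite (g ` B)" "card (g ` B) \<le> M" "\<forall>m. solv M T A {b \<in> B. g b = m} f"
    by auto
  then show ?case
  proof cases
    case a
    have sub: "(g \<circ> \<sigma>) ` A' \<subseteq> g ` A" using Suc.prems(2) by auto
    have "solv M T {a \<in> A'. (g \<circ> \<sigma>) a = m} B' f'" for m
      by (rule Suc.IH[OF a(3)[rule_format, of m]]) (use Suc.prems in auto)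
    moreover have "card ((g \<circ> \<sigma>) ` A') \<le> M" using card_mono[OF a(1) sub] a(2) by linarith
    ultimately show ?thesis using finite_subset[OF sub a(1)] unfolding solv.simps by blast
  next
    case b
    have sub: "(g \<circ> \<tau>) ` B' \<subseteq> g ` B" using Suc.prems(3) by auto
    have "solv M T A' {a \<in> B'. (g \<circ> \<tau>) a = m} f'" for m
      by (rule Suc.IH[OF b(3)[rule_format, of m]]) (use Suc.prems in auto)
    moreover have "card ((g \<circ> \<tau>) ` B') \<le> M" using card_mono[OF b(1) sub] b(2) by linarith
    ultimately show ?thesis using finite_subset[OF sub b(1)] unfolding solv.simps by blast
  qed
qed

lemma solv_swap: "solv M T A B f \<Longrightarrow> solv M T B A (\<lambda>b a. f a b)"
proof (induction T arbitrary: A B)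
  case (Suc T)
  from Suc.prems consider
    (a) g :: "'a \<Rightarrow> msg" where "finite (g ` A)" "card (g ` A) \<le> M" "\<forall>m. solv M T {a \<in> A. g a = m} B f"
  | (b) g :: "'b \<Rightarrow> msg" where "finite (g ` B)" "card (g ` B) \<le> M" "\<forall>m. solv M T A {b \<in> B. g b = m} f"
    by auto
  then show ?case
  proof cases
    case a
    then have "\<forall>m. solv M T B {a \<in> A. g a = m} (\<lambda>b a. f a b)" using Suc.IH by blast
    with a(1,2) show ?thesis unfolding solv.simps by (intro disjI2 exI[of _ g]) simp
  next
    case b
    then have "\<forall>m. solv M T {b \<in> B. g b = m} A (\<lambda>b a. f a b)" using Suc.IH by blast
    with b(1,2) show ?thesis unfolding solv.simps by (intro disjI1 exI[of _ g]) simp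
  qed
qed auto

text \<open>Pads a protocol that stops early to full depth by constant messages.\<close>

lemma solv_const:
  assumes "\<And>a b. a \<in> A \<Longrightarrow> b \<in> B \<Longrightarrow> f a b = v" "M \<ge> 1"
  shows "solv M T A B f"
  using assms(1)
proof (induction T arbitrary: A)
  case (Suc T)
  have "card ((\<lambda>_. Bit True) ` A) \<le> 1" by (simp add: image_constant_conv)
  then have "card ((\<lambda>_. Bit True) ` A) \<le> M" using assms(2) by linarith
  moreover have "solv M T {a \<in> A. Bit True = m} B f" for m by (rule Suc.IH) (use Suc.prems in auto)
  moreover have "finite ((\<lambda>_. Bit True) ` A)" by (simp add: image_constant_conv)
  ultimately show ?case unfolding solv.simps by (intro disjI1 exI[of _ "\<lambda>_. Bit True"]) simp
qed auto

lemma large_fibre: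
  assumes "finite A" "finite (g ` A)" "card (g ` A) \<le> M"
  obtains m where "card A \<le> M * card {a \<in> A. g a = m}"
proof (cases "A = {}")
  case False
  define F where "F = (\<lambda>m. card {a \<in> A. g a = m})"
  have ne: "F ` g ` A \<noteq> {}" and fin: "finite (F ` g ` A)" using False assms by auto
  obtain m where m: "m \<in> g ` A" "F m = Max (F ` g ` A)"
    using Max_in[OF fin ne] by (metis (no_types, lifting) imageE)
  have "card A = (\<Sum>y\<in>g ` A. F y)"
    using sum.image_gen[OF assms(1), of "\<lambda>_. 1::nat" g] by (simp add: F_def)
  also have "\<dots> \<le> card (g ` A) * F m"
    using sum_bounded_above[of "g ` A" F "F m"] Max_ge[OF fin] m(2) by simp
  also have "\<dots> \<le> M * F m" using assms(3) by simp
  finally show thesis using that F_def by blast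
qed (use that in auto)

text \<open>Fixing the speaker's most frequent message costs the speaker a factor of at most
  \<open>M\<close> in density and leaves the other side untouched.\<close>

lemma solv_Suc_cases:
  assumes "solv M (Suc T) A B f" "finite A" "finite B"
  obtains (first) A' where "A' \<subseteq> A" "card A \<le> M * card A'" "solv M T A' B f"
  | (second) B' where "B' \<subseteq> B" "card B \<le> M * card B'" "solv M T A B' f"
proof -
  from assms(1) consider
    (a) g :: "'a \<Rightarrow> msg" where "finite (g ` A)" "card (g ` A) \<le> M" "\<forall>m. solv M T {a \<in> A. g a = m} B f"
  | (b) g :: "'b \<Rightarrow> msg" where "finite (g ` B)" "card (g ` B) \<le> M" "\<forall>m. solv M T A {b \<in> B. g b = m} f"
    by auto
  then show thesis
  proof cases
    case a
    then obtain m where "card A \<le> M * card {a \<in> A. g a = m}" using large_fibre assms(2) by blast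
    then show thesis using a(3) first[of "{a \<in> A. g a = m}"] by auto
  next
    case b
    then obtain m where "card B \<le> M * card {a \<in> B. g a = m}" using large_fibre assms(3) by blast
    then show thesis using b(3) second[of "{a \<in> B. g a = m}"] by auto
  qed
qed

section \<open>Pointer jumping on a tree and round elimination\<close>

datatype inp = Leaf bool | Arr "inp list" | Idx nat inp

text \<open>On level 0 the answer sits with the pointer holder, and the array holder has a dummy
  input.\<close>

fun arrs :: "nat \<Rightarrow> nat \<Rightarrow> inp set" and idxs :: "nat \<Rightarrow> nat \<Rightarrow> inp set" where
  "arrs d 0 = {Leaf True}"
| "arrs d (Suc k) = Arr ` {l. set l \<subseteq> idxs d k \<and> length l = d}"
| "idxs d 0 = {Leaf True, Leaf False}"
| "idxs d (Suc k) = (\<lambda>(i, x). Idx i x) ` ({..<d} \<times> arrs d k)"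

text \<open>The roles alternate: the holder of the array has the pointer on the next level.\<close>

fun jump :: "nat \<Rightarrow> inp \<Rightarrow> inp \<Rightarrow> bool" where
  "jump 0 a b \<longleftrightarrow> b = Leaf True"
| "jump (Suc k) (Arr l) (Idx i x) = jump k x (l ! i)"
| "jump (Suc k) _ _ = False"

section \<open>Slices, projections and their densities\<close>

definition row :: "nat \<Rightarrow> inp set \<Rightarrow> inp set" where "row i B = {x. Idx i x \<in> B}"
definition col :: "nat \<Rightarrow> inp set \<Rightarrow> inp set" where "col i A = {l ! i |l. Arr l \<in> A}"

lemma finite_arrs_idxs: "finite (arrs d k) \<and> finite (idxs d k)"
  by (induction k) (auto intro: finite_lists_length_eq)

lemmas finite_arrs = finite_arrs_idxs[THEN conjunct1]
  and finite_idxs = finite_arrs_idxs[THEN conjunct2]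

lemma card_arrs_Suc: "card (arrs d (Suc k)) = card (idxs d k) ^ d"
  by (simp add: card_image inj_on_def card_lists_length_eq finite_idxs)

lemma card_idxs_Suc: "card (idxs d (Suc k)) = d * card (arrs d k)"
proof -
  have "inj_on (\<lambda>(i, x). Idx i x) ({..<d} \<times> arrs d k)" by (auto simp: inj_on_def)
  then show ?thesis by (simp add: card_image card_cartesian_product)
qed

lemma row_subset: "B \<subseteq> idxs d (Suc k) \<Longrightarrow> row i B \<subseteq> arrs d k"
  by (auto simp: row_def)

lemma col_subset: "A \<subseteq> arrs d (Suc k) \<Longrightarrow> i < d \<Longrightarrow> col i A \<subseteq> idxs d k"
  by (force simp: col_def dest!: subsetD)

text \<open>Once the pointer is \<open>i\<close>, the other entries do not affect the value, so any
  array in \<open>A\<close> with the right entry at \<open>i\<close> may stand in for the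
  subinstance. Thus \<open>B\<close> is cut down to a slice while \<open>A\<close> is merely
  projected.\<close>

lemma solv_descend:
  assumes "A \<subseteq> arrs d (Suc k)" "solv M T A B (jump (Suc k))"
  shows "solv M T (row i B) (col i A) (jump k)"
proof -
  define \<sigma> where "\<sigma> = (\<lambda>y. SOME a. a \<in> A \<and> (\<exists>l. a = Arr l \<and> l ! i = y))"
  have \<sigma>: "\<sigma> y \<in> A \<and> (\<exists>l. \<sigma> y = Arr l \<and> l ! i = y)" if "y \<in> col i A" for y
    unfolding \<sigma>_def by (rule someI_ex) (use that in \<open>auto simp: col_def\<close>)
  have "solv M T (col i A) (row i B) (\<lambda>y x. jump k x y)"
  proof (rule solv_reindex[OF assms(2), where \<sigma> = \<sigma> and \<tau> = "Idx i"])
    fix y x assume "y \<in> col i A"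
    then obtain l where "\<sigma> y = Arr l" "l ! i = y" using \<sigma> by blast
    then show "jump k x y = jump (Suc k) (\<sigma> y) (Idx i x)" by simp
  qed (use \<sigma> in \<open>auto simp: row_def\<close>)
  from solv_swap[OF this] show ?thesis .
qed

text \<open>An array is determined by its entries, so \<open>A\<close> embeds into the product of
  its projections.\<close>

lemma card_le_prod_col:
  assumes "A \<subseteq> arrs d (Suc k)"
  shows "card A \<le> (\<Prod>i<d. card (col i A))"
proof -
  define L where "L = {l. Arr l \<in> A}"
  have A: "A = Arr ` L" using assms by (auto simp: L_def)
  have len: "length l = d" if "l \<in> L" for l using that assms by (auto simp: L_def)
  define F where "F = (\<lambda>l::inp list. \<lambda>i\<in>{..<d}. l ! i)"
  have inj: "inj_on F L"
  proof (rule inj_onI)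
    fix l l' assume *: "l \<in> L" "l' \<in> L" "F l = F l'"
    show "l = l'"
    proof (rule nth_equalityI)
      show "length l = length l'" using * len by simp
      show "l ! i = l' ! i" if "i < length l" for i
        using fun_cong[OF *(3), of i] that len[OF *(1)] by (simp add: F_def)
    qed
  qed
  have sub: "F ` L \<subseteq> (\<Pi>\<^sub>E i\<in>{..<d}. col i A)"
  proof (rule image_subsetI)
    fix l assume "l \<in> L"
    then show "F l \<in> (\<Pi>\<^sub>E i\<in>{..<d}. col i A)"
      unfolding F_def restrict_PiE_iff by (auto simp: L_def col_def)
  qed
  have "finite (\<Pi>\<^sub>E i\<in>{..<d}. col i A)"
    by (rule finite_PiE) (use finite_subset[OF col_subset[OF assms] finite_idxs] in auto)
  then have "card (F ` L) \<le> card (\<Pi>\<^sub>E i\<in>{..<d}. col i A)" using sub by (rule card_mono)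
  moreover have "card A = card (F ` L)" using inj by (simp add: A card_image inj_on_def)
  ultimately show ?thesis by (simp add: card_PiE)
qed

lemma card_eq_sum_row:
  assumes "B \<subseteq> idxs d (Suc k)"
  shows "card B = (\<Sum>i<d. card (row i B))"
proof -
  have "B = (\<lambda>(i, x). Idx i x) ` (SIGMA i:{..<d}. row i B)"
    using assms by (force simp: row_def image_iff)
  moreover have "inj_on (\<lambda>(i, x). Idx i x) (SIGMA i:{..<d}. row i B)" by (auto simp: inj_on_def)
  ultimately have "card B = card (SIGMA i:{..<d}. row i B)" by (metis card_image)
  then show ?thesis
    using finite_subset[OF row_subset[OF assms] finite_arrs] by simp
qed

text \<open>If \<open>m\<close> projections all had density below 3/4, the product bound would push
  the density of \<open>A\<close> down to \<open>(3/4) ^ m\<close>, which is less than 1/(16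
  M).\<close>

lemma col_dense:
  assumes A: "A \<subseteq> arrs d (Suc k)" and G: "G \<subseteq> {..<d}" "m \<le> card G"
    and m: "16 * real M * (3/4) ^ m < 1"
    and dense: "real (card (arrs d (Suc k))) \<le> 16 * real M * real (card A)"
    and ne: "idxs d k \<noteq> {}"
  shows "\<exists>i\<in>G. 3/4 * real (card (idxs d k)) \<le> real (card (col i A))"
proof (rule ccontr)
  assume "\<not> ?thesis"
  then have small: "real (card (col i A)) \<le> 3/4 * real (card (idxs d k))" if "i \<in> G" for i
    using that by force
  define Y where "Y = real (card (idxs d k))"
  have Y: "Y > 0" using ne finite_idxs[of d k] by (simp add: Y_def card_gt_0_iff)
  have "real (card A) \<le> (\<Prod>i<d. real (card (col i A)))"
    using card_le_prod_col[OF A] by (metis of_nat_le_iff of_nat_prod)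
  also have "\<dots> \<le> (\<Prod>i<d. (if i \<in> G then 3/4 else 1) * Y)"
    using small card_mono[OF finite_idxs col_subset[OF A]] by (intro prod_mono) (auto simp: Y_def)
  also have "\<dots> = (3/4) ^ card G * Y ^ d"
    using G(1) by (simp add: prod.distrib prod.If_cases Int_absorb1)
  also have "\<dots> \<le> (3/4) ^ m * Y ^ d"
    using G(2) Y by (intro mult_right_mono power_decreasing) auto
  finally have "16 * real M * real (card A) \<le> 16 * real M * ((3/4) ^ m * Y ^ d)"
    by (intro mult_left_mono) auto
  also have "\<dots> = (16 * real M * (3/4) ^ m) * Y ^ d" by simp
  also have "\<dots> < 1 * Y ^ d" using m Y by (intro mult_strict_right_mono) auto
  finally show False using dense by (simp add: card_arrs_Suc Y_def del: arrs.simps)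
qed

text \<open>Rows thinner than \<open>b / 2\<close> account for at most half of the mass
  \<open>b\<close>; the rest lies in the other rows, each of density at most 1.\<close>

lemma row_dense:
  assumes B: "B \<subseteq> idxs d (Suc k)" and b: "0 \<le> b" "b * real (card (idxs d (Suc k))) \<le> real (card B)"
    and ne: "arrs d k \<noteq> {}"
  shows "b / 2 * real d \<le> real (card {i \<in> {..<d}. b / 2 * real (card (arrs d k)) \<le> real (card (row i B))})"
proof -
  define X where "X = real (card (arrs d k))"
  define G where "G = {i \<in> {..<d}. b / 2 * X \<le> real (card (row i B))}"
  have X: "X > 0" using ne finite_arrs[of d k] by (simp add: X_def card_gt_0_iff)
  have "b * (d * X) \<le> real (card B)" using b(2) by (simp add: card_idxs_Suc X_def del: idxs.simps)
  also have "\<dots> = (\<Sum>i<d. real (card (row i B)))" by (simp add: card_eq_sum_row[OF B])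
  also have "\<dots> \<le> (\<Sum>i<d. (if i \<in> G then X else 0) + b / 2 * X)"
    using card_mono[OF finite_arrs row_subset[OF B]] b(1) X
    by (intro sum_mono) (auto simp: G_def X_def intro: add_increasing2)
  also have "\<dots> = real (card G) * X + d * (b / 2 * X)"
    by (simp add: sum.distrib sum.If_cases G_def Int_def)
  finally have "(b / 2 * d) * X \<le> real (card G) * X" by (simp add: algebra_simps)
  then show ?thesis using X by (simp add: G_def X_def)
qed

text \<open>The factor 32 makes \<open>b / 2 * d\<close> at least \<open>m\<close> whenever b >=
  1/16. The condition on \<open>m\<close> is the one for \<open>col_dense\<close>, and M >= 2
  absorbs the density 1/32 >= 1/(16 M) arising in \<open>hard_Suc_rounds\<close>.\<close>

locale round_elimination =
  fixes d m M :: nat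
  assumes d: "d = 32 * m" and m: "16 * real M * (3/4) ^ m < 1" and M: "M \<ge> 2"
begin

lemma m_pos: "m > 0"
  using m M by (cases m) auto

lemma arrs_idxs_ne: "arrs d k \<noteq> {} \<and> idxs d k \<noteq> {}"
proof (induction k)
  case (Suc k)
  then obtain y where "y \<in> idxs d k" by blast
  then have "replicate d y \<in> {l. set l \<subseteq> idxs d k \<and> length l = d}" by auto
  moreover have "0 < d" using d m_pos by simp
  ultimately show ?case using Suc by (auto simp del: mem_Collect_eq)
qed auto

text \<open>\<open>row_dense\<close> supplies \<open>m\<close> good pointers, too many for all their
  projections to be thin, so \<open>col_dense\<close> finds one that is good for both sides.\<close>

lemma descent:
  assumes A: "A \<subseteq> arrs d (Suc k)" and B: "B \<subseteq> idxs d (Suc k)"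
    and dA: "real (card (arrs d (Suc k))) \<le> 16 * real M * real (card A)"
    and dB: "b * real (card (idxs d (Suc k))) \<le> real (card B)" "1/16 \<le> b"
  shows "\<exists>i<d. b / 2 * real (card (arrs d k)) \<le> real (card (row i B)) \<and>
               3/4 * real (card (idxs d k)) \<le> real (card (col i A))"
proof -
  define G where "G = {i \<in> {..<d}. b / 2 * real (card (arrs d k)) \<le> real (card (row i B))}"
  have "b / 2 * real d \<le> real (card G)"
    unfolding G_def by (rule row_dense[OF B]) (use dB arrs_idxs_ne in auto)
  moreover have "real m \<le> b / 2 * real d" using dB(2) d mult_right_mono[of "1/16" b "real m"] by simp
  ultimately have "m \<le> card G" by linarith
  then have "\<exists>i\<in>G. 3/4 * real (card (idxs d k)) \<le> real (card (col i A))"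
    using col_dense[OF A _ _ m dA, of G] arrs_idxs_ne[of k] by (auto simp: G_def)
  then show ?thesis unfolding G_def by blast
qed

text \<open>The asymmetry between 1/16 and 3/4 reflects that a projection of the array can be made
  almost full, whereas conditioning on the value of a pointer loses a constant factor.\<close>

definition hard :: "nat \<Rightarrow> nat \<Rightarrow> bool" where
  "hard T k \<longleftrightarrow> (\<forall>A B. A \<subseteq> arrs d k \<longrightarrow> B \<subseteq> idxs d k \<longrightarrow>
     1/16 * real (card (arrs d k)) \<le> real (card A) \<longrightarrow> 3/4 * real (card (idxs d k)) \<le> real (card B) \<longrightarrow>
     \<not> solv M T A B (jump k))"

text \<open>The arrays may be as thin as 1/(16 M), as after a message of their holder. One level
  down the roles are exchanged and the densities are 3/8 >= 1/16 and 3/4, as \<open>hard\<close>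
  demands.\<close>

lemma hard_descent:
  assumes "hard T k" and A: "A \<subseteq> arrs d (Suc k)" and B: "B \<subseteq> idxs d (Suc k)"
    and dA: "real (card (arrs d (Suc k))) \<le> 16 * real M * real (card A)"
    and dB: "3/4 * real (card (idxs d (Suc k))) \<le> real (card B)"
  shows "\<not> solv M T A B (jump (Suc k))"
proof
  assume s: "solv M T A B (jump (Suc k))"
  from descent[OF A B dA dB] obtain i where i: "i < d"
    "3/4 / 2 * real (card (arrs d k)) \<le> real (card (row i B))"
    "3/4 * real (card (idxs d k)) \<le> real (card (col i A))" by auto
  have "solv M T (row i B) (col i A) (jump k)" by (rule solv_descend[OF A s])
  moreover have "1/16 * real (card (arrs d k)) \<le> real (card (row i B))" using i(2) by simp
  ultimately show False
    using assms(1) i row_subset[OF B] col_subset[OF A i(1)] unfolding hard_def by blast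
qed

lemma hard_Suc_level:
  assumes "hard T k" shows "hard T (Suc k)"
  unfolding hard_def
proof (intro allI impI)
  fix A B assume *: "A \<subseteq> arrs d (Suc k)" "B \<subseteq> idxs d (Suc k)"
     "1/16 * real (card (arrs d (Suc k))) \<le> real (card A)"
     "3/4 * real (card (idxs d (Suc k))) \<le> real (card B)"
  have "1 * real (card A) \<le> real M * real (card A)" using M by (intro mult_right_mono) auto
  then have "real (card (arrs d (Suc k))) \<le> 16 * real M * real (card A)" using *(3) by linarith
  then show "\<not> solv M T A B (jump (Suc k))" using hard_descent assms * by blast
qed

text \<open>Density 3/4 in a set of two elements forces both leaves into \<open>B\<close>.\<close>

lemma hard_0: "hard 0 0"
  unfolding hard_def
proof (intro allI impI)
  fix A B assume *: "A \<subseteq> arrs d 0" "B \<subseteq> idxs d 0"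
     "1/16 * real (card (arrs d 0)) \<le> real (card A)" "3/4 * real (card (idxs d 0)) \<le> real (card B)"
  have "card (idxs d 0) \<le> card B" using *(4) by simp
  then have "B = idxs d 0" using card_seteq[OF finite_idxs *(2)] by blast
  moreover have "A \<noteq> {}" using *(3) by auto
  ultimately show "\<not> solv M 0 A B (jump 0)" by auto
qed

text \<open>A message of the array holder is repaired in one level. A message of the pointer holder
  takes three: the first makes its sender the array holder, for whom a loss of factor
  \<open>M\<close> is harmless; the second makes the sender's projection 3/4 dense; the third
  repairs the other player's density.\<close>

lemma hard_Suc_rounds:
  assumes "hard T k" shows "hard (Suc T) (Suc (Suc (Suc k)))"
  unfolding hard_def
proof (intro allI impI notI)
  let ?K = "Suc (Suc k)"
  fix A B assume A: "A \<subseteq> arrs d (Suc ?K)" and B: "B \<subseteq> idxs d (Suc ?K)"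
    and dA: "1/16 * real (card (arrs d (Suc ?K))) \<le> real (card A)"
    and dB: "3/4 * real (card (idxs d (Suc ?K))) \<le> real (card B)"
    and s: "solv M (Suc T) A B (jump (Suc ?K))"
  have fin: "finite A" "finite B"
    using finite_subset[OF A finite_arrs] finite_subset[OF B finite_idxs] .
  from s fin show False
  proof (cases rule: solv_Suc_cases)
    case (first A')
    have "real (card A) \<le> real M * real (card A')" using first(2) by (metis of_nat_le_iff of_nat_mult)
    then have "real (card (arrs d (Suc ?K))) \<le> 16 * real M * real (card A')" using dA by linarith
    moreover have "A' \<subseteq> arrs d (Suc ?K)" using first(1) A by blast
    moreover have "hard T ?K" using assms hard_Suc_level by blast
    ultimately show False using hard_descent B dB first(3) by blast
  next
    case (second B')
    have B': "B' \<subseteq> idxs d (Suc ?K)" using second(1) B by blast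
    define X where "X = real (card (arrs d ?K))"
    define Y where "Y = real (card (idxs d ?K))"
    have Y: "Y > 0" using arrs_idxs_ne finite_idxs by (simp add: Y_def card_gt_0_iff del: idxs.simps)
    have dpos: "d > 0" using d m_pos by simp
    have "real (card B) \<le> real M * real (card B')" using second(2) by (metis of_nat_le_iff of_nat_mult)
    then have "3/4 * (d * X) \<le> real M * real (card B')" using dB by (simp add: X_def card_idxs_Suc del: idxs.simps)
    also have "\<dots> = (\<Sum>i<d. real M * real (card (row i B')))"
      by (simp add: card_eq_sum_row[OF B'] sum_distrib_left)
    finally have le: "(\<Sum>i<d. 3/4 * X) \<le> (\<Sum>i<d. real M * real (card (row i B')))" by simp
    \<comment> \<open>By averaging, some slice has at least the density 3/(4 M) of
      \<open>B'\<close>.\<close>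
    have "\<exists>i<d. 3/4 * X \<le> real M * real (card (row i B'))"
    proof (rule ccontr)
      assume "\<not> ?thesis"
      then have "(\<Sum>i<d. real M * real (card (row i B'))) < (\<Sum>i<d. 3/4 * X)"
        using dpos by (intro sum_strict_mono) (auto simp: not_le)
      then show False using le by simp
    qed
    then obtain i where i: "i < d" "3/4 * X \<le> real M * real (card (row i B'))" by blast
    \<comment> \<open>Bounding all other projections by their full size leaves projection
      \<open>i\<close> at least the density 1/16 of \<open>A\<close>, whichever \<open>i\<close> was
      chosen.\<close>
    have "real (card A) \<le> (\<Prod>j<d. real (card (col j A)))"
      using card_le_prod_col[OF A] by (metis of_nat_le_iff of_nat_prod)
    also have "\<dots> = real (card (col i A)) * (\<Prod>j\<in>{..<d} - {i}. real (card (col j A)))"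
      using i(1) by (intro prod.remove) auto
    also have "\<dots> \<le> real (card (col i A)) * (\<Prod>j\<in>{..<d} - {i}. Y)"
      using card_mono[OF finite_idxs col_subset[OF A]]
      by (intro mult_left_mono prod_mono) (auto simp: Y_def)
    finally have "real (card A) \<le> real (card (col i A)) * Y ^ (d - 1)" using i(1) by simp
    moreover have "real (card (arrs d (Suc ?K))) = Y * Y ^ (d - 1)"
      unfolding card_arrs_Suc Y_def of_nat_power using power_minus_mult[OF dpos] by (metis mult.commute)
    ultimately have "(1/16 * Y) * Y ^ (d - 1) \<le> real (card (col i A)) * Y ^ (d - 1)"
      using dA by linarith
    then have c: "1/16 * Y \<le> real (card (col i A))" using Y mult_right_le_imp_le zero_less_power by blast
    have A1: "row i B' \<subseteq> arrs d ?K" and B1: "col i A \<subseteq> idxs d ?K"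
      using row_subset[OF B'] col_subset[OF A i(1)] by auto
    have s1: "solv M T (row i B') (col i A) (jump ?K)" by (rule solv_descend[OF A second(3)])
    have dA1: "real (card (arrs d ?K)) \<le> 16 * real M * real (card (row i B'))"
      using i(2) unfolding X_def by linarith
    \<comment> \<open>The roles are now exchanged; the pointer side has density 1/16, the least that
      \<open>descent\<close> admits.\<close>
    from descent[OF A1 B1 dA1 c[unfolded Y_def]] obtain j where j: "j < d"
      "1/16 / 2 * real (card (arrs d (Suc k))) \<le> real (card (row j (col i A)))"
      "3/4 * real (card (idxs d (Suc k))) \<le> real (card (col j (row i B')))" by auto
    have s2: "solv M T (row j (col i A)) (col j (row i B')) (jump (Suc k))"
      by (rule solv_descend[OF A1 s1])
    have "2 * real (card (row j (col i A))) \<le> real M * real (card (row j (col i A)))"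
      using M by (intro mult_right_mono) auto
    then have "real (card (arrs d (Suc k))) \<le> 16 * real M * real (card (row j (col i A)))"
      using j(2) by linarith
    then show False
      using hard_descent[OF assms row_subset[OF B1] col_subset[OF A1 j(1)]] j(3) s2 by blast
  qed
qed

lemma hard_rounds: "hard T (3 * T)"
proof (induction T)
  case (Suc T)
  then show ?case using hard_Suc_rounds[of T "3 * T"] by (simp add: numeral_3_eq_3)
qed (simp add: hard_0)

lemma not_solv_jump: "\<not> solv M T (arrs d (3 * T)) (idxs d (3 * T)) (jump (3 * T))"
  using hard_rounds[of T] unfolding hard_def by simp

end

section \<open>Embedding pointer jumping into the plane\<close>

text \<open>One bound for coordinates, slopes and intercepts on all levels. The scales shrink
  quantities of this size to horizontal shifts and slope changes of at most 1/8 and vertical shifts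
  of at most 1/16, small against the unit spacing of the copies.\<close>

definition span :: "nat \<Rightarrow> real" where "span d = 2 * (real d)\<^sup>2"
definition xscale :: "nat \<Rightarrow> real" where "xscale d = 1 / (8 * span d)"
definition yscale :: "nat \<Rightarrow> real" where "yscale d = 1 / (32 * span d ^ 3)"

text \<open>A tiny, even flatter and upside-down copy of the plane at the point \<open>(i, i\<^sup>2)\<close> of the standard
  parabola, sheared along the tangent there.\<close>

definition place :: "nat \<Rightarrow> nat \<Rightarrow> point \<Rightarrow> point" where
  "place d i p = (real i + xscale d * fst p,
     (real i)\<^sup>2 + 2 * real i * (xscale d * fst p) - yscale d * snd p)"

text \<open>Slope and intercept of the image under \<open>place d i\<close> of the line y = s x +
  t.\<close>

definition slope :: "nat \<Rightarrow> nat \<Rightarrow> real \<Rightarrow> real" where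
  "slope d i s = 2 * real i - yscale d * s / xscale d"
definition offset :: "nat \<Rightarrow> nat \<Rightarrow> real \<Rightarrow> real \<Rightarrow> real" where
  "offset d i s t = yscale d * s / xscale d * real i - (real i)\<^sup>2 - yscale d * t"

text \<open>The array holder's points are to lie above the line. As \<open>place\<close> flips the
  plane, the exchange of roles turns into an exchange of \<open>upts\<close> and
  \<open>lpts\<close>. On level 0 the two points coincide exactly when the answer is false.\<close>

fun upts :: "nat \<Rightarrow> nat \<Rightarrow> inp \<Rightarrow> point set" and lpts :: "nat \<Rightarrow> nat \<Rightarrow> inp \<Rightarrow> point set" where
  "upts d 0 a = {(0, 0)}"
| "upts d (Suc k) (Arr l) = (\<Union>i<d. place d i ` lpts d k (l ! i))"
| "upts d (Suc k) _ = {}"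
| "lpts d 0 b = {if b = Leaf True then (0, -1) else (0, 0)}"
| "lpts d (Suc k) (Idx i x) = place d i ` upts d k x"
| "lpts d (Suc k) _ = {}"

text \<open>The number of available positions, not that of inputs, bounds both the sample size and
  the number of messages.\<close>

fun pts :: "nat \<Rightarrow> nat \<Rightarrow> point set" where
  "pts d 0 = {(0, 0), (0, -1)}"
| "pts d (Suc k) = (\<Union>i<d. place d i ` pts d k)"

lemma card_pts: "finite (pts d k) \<and> card (pts d k) \<le> 2 * d ^ k"
proof (induction k)
  case (Suc k)
  have "card (pts d (Suc k)) \<le> (\<Sum>i<d. card (place d i ` pts d k))"
    by (simp add: card_UN_le)
  also have "\<dots> \<le> (\<Sum>i<d. 2 * d ^ k)"
    using Suc by (intro sum_mono order_trans[OF card_image_le]) auto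
  finally show ?case using Suc by simp
qed auto

lemma upts_lpts_subset:
  "(a \<in> arrs d k \<longrightarrow> upts d k a \<subseteq> pts d k) \<and> (b \<in> idxs d k \<longrightarrow> lpts d k b \<subseteq> pts d k)"
proof (induction k arbitrary: a b)
  case (Suc k)
  have 1: "upts d (Suc k) a \<subseteq> pts d (Suc k)" if a: "a \<in> arrs d (Suc k)"
  proof -
    obtain l where l: "a = Arr l" "set l \<subseteq> idxs d k" "length l = d" using a by auto
    have "lpts d k (l ! i) \<subseteq> pts d k" if "i < d" for i using Suc l that nth_mem by blast
    then show ?thesis using l(1) by fastforce
  qed
  have 2: "lpts d (Suc k) b \<subseteq> pts d (Suc k)" if b: "b \<in> idxs d (Suc k)"
  proof -
    obtain i x where i: "b = Idx i x" "i < d" "x \<in> arrs d k" using b by auto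
    then have "upts d k x \<subseteq> pts d k" using Suc by blast
    then show ?thesis using i by auto
  qed
  show ?case using 1 2 by blast
qed auto

lemma upts_lpts_nonempty:
  assumes "d > 0"
  shows "(a \<in> arrs d k \<longrightarrow> upts d k a \<noteq> {}) \<and> (b \<in> idxs d k \<longrightarrow> lpts d k b \<noteq> {})"
proof (induction k arbitrary: a b)
  case (Suc k)
  have 1: "upts d (Suc k) a \<noteq> {}" if a: "a \<in> arrs d (Suc k)"
  proof -
    obtain l where l: "a = Arr l" "set l \<subseteq> idxs d k" "length l = d" using a by auto
    then have "lpts d k (l ! 0) \<noteq> {}" using Suc assms nth_mem by blast
    then show ?thesis using assms l(1) by auto
  qed
  have 2: "lpts d (Suc k) b \<noteq> {}" if b: "b \<in> idxs d (Suc k)"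
    using b Suc by auto
  show ?case using 1 2 by blast
qed auto

section \<open>Uniform bounds on coordinates\<close>

lemma span_ge_2:
  assumes "d > 0" shows "span d \<ge> 2"
proof -
  have "1 \<le> (real d)\<^sup>2" using assms by (intro one_le_power) simp
  then show ?thesis by (simp add: span_def)
qed

lemma scales_pos: "d > 0 \<Longrightarrow> xscale d > 0 \<and> yscale d > 0"
  using span_ge_2[of d] by (auto simp: xscale_def yscale_def)

lemma scale_bounds:
  assumes "d > 0" "\<bar>z\<bar> \<le> span d"
  shows "\<bar>xscale d * z\<bar> \<le> 1/8" "\<bar>yscale d * z\<bar> \<le> 1/16" "\<bar>yscale d * z / xscale d\<bar> \<le> 1/8"
proof -
  define D where "D = span d"
  have D: "D \<ge> 2" "\<bar>z\<bar> \<le> D" using span_ge_2[OF assms(1)] assms(2) by (auto simp: D_def)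
  have x: "\<bar>xscale d * z\<bar> = \<bar>z\<bar> / (8 * D)"
    using D by (simp add: xscale_def D_def abs_mult)
  also have "\<dots> \<le> 1/8" using D by (simp add: divide_simps)
  finally show x8: "\<bar>xscale d * z\<bar> \<le> 1/8" .
  have "D * 2 \<le> D * D" using D by (intro mult_left_mono) auto
  then have DD: "D * D \<ge> 4" using D by linarith
  have "\<bar>yscale d * z\<bar> = \<bar>xscale d * z\<bar> / (4 * (D * D))"
    unfolding x using D by (simp add: yscale_def D_def abs_mult power3_eq_cube)
  also have "\<dots> \<le> (1/8) / (4 * 4)" by (rule frac_le) (use x8 DD in auto)
  finally show "\<bar>yscale d * z\<bar> \<le> 1/16" by simp
  have "\<bar>yscale d * z / xscale d\<bar> = \<bar>z\<bar> / (4 * (D * D))"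
    using D by (simp add: yscale_def xscale_def D_def abs_mult power3_eq_cube)
  also have "\<dots> \<le> D / (4 * (2 * D))" by (rule frac_le) (use D \<open>D * 2 \<le> D * D\<close> in auto)
  finally show "\<bar>yscale d * z / xscale d\<bar> \<le> 1/8" using D by simp
qed

text \<open>Since i <= d - 1, \<open>span d\<close> leaves room beyond i^2 for perturbations; the
  term i/4 is 2 i times a horizontal shift of 1/8.\<close>

lemma span_absorbs:
  assumes "i < d"
  shows "2 * real i + 1/8 \<le> span d" "(real i)\<^sup>2 + 1/4 * real i + 1/8 \<le> span d"
proof -
  have i: "real i \<le> real d - 1" using assms by linarith
  have "(real i)\<^sup>2 \<le> (real d - 1)\<^sup>2" using i by (intro power_mono) auto
  also have "\<dots> = real d * real d - 2 * real d + 1" by (simp add: power2_eq_square algebra_simps)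
  finally have "(real i)\<^sup>2 \<le> real d * real d - 2 * real d + 1" .
  moreover have "real d * 1 \<le> real d * real d" using assms by (intro mult_left_mono) auto
  ultimately show "2 * real i + 1/8 \<le> span d" "(real i)\<^sup>2 + 1/4 * real i + 1/8 \<le> span d"
    unfolding span_def power2_eq_square[of "real d"] using i by linarith+
qed

lemma pts_bounded:
  assumes "d > 0" "p \<in> pts d k"
  shows "\<bar>fst p\<bar> \<le> span d \<and> \<bar>snd p\<bar> \<le> span d"
  using assms(2)
proof (induction k arbitrary: p)
  case 0
  then show ?case using span_ge_2[OF assms(1)] by auto
next
  case (Suc k)
  obtain i q where q: "i < d" "q \<in> pts d k" "p = place d i q" using Suc.prems by auto
  define u where "u = xscale d * fst q"
  define v where "v = yscale d * snd q"
  have uv: "\<bar>u\<bar> \<le> 1/8" "\<bar>v\<bar> \<le> 1/16"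
    unfolding u_def v_def using Suc.IH[OF q(2)] scale_bounds[OF assms(1)] by auto
  have "\<bar>real i * u\<bar> \<le> real i * (1/8)" 
    unfolding abs_mult abs_of_nat using uv by (intro mult_left_mono) auto
  then have "\<bar>(real i)\<^sup>2 + 2 * (real i * u) - v\<bar> \<le> span d" "\<bar>real i + u\<bar> \<le> span d"
    using uv span_absorbs[OF q(1)] zero_le_power2[of "real i"] by linarith+
  then show ?case by (simp add: q(3) place_def u_def v_def mult.assoc)
qed

text \<open>A false value of \<^const>\<open>jump\<close> shows up as a point belonging to both sets, a true one as a
  strictly separating line of bounded slope.\<close>

lemma common_point:
  assumes "a \<in> arrs d k" "b \<in> idxs d k" "\<not> jump k a b"
  shows "upts d k a \<inter> lpts d k b \<noteq> {}"
  using assms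
proof (induction k arbitrary: a b)
  case (Suc k)
  obtain l where l: "a = Arr l" "set l \<subseteq> idxs d k" "length l = d" using Suc.prems by auto
  obtain i x where i: "b = Idx i x" "i < d" "x \<in> arrs d k" using Suc.prems by auto
  have "l ! i \<in> idxs d k" using l i nth_mem by blast
  then have "upts d k x \<inter> lpts d k (l ! i) \<noteq> {}" using Suc.IH[OF i(3)] Suc.prems(3) l i by simp
  then show ?case using l i by auto
qed auto

text \<open>The line \<open>y = s x + t\<close> of the flipped copy at \<open>(i, i\<^sup>2)\<close> becomes almost tangent to the
  parabola there, so it stays strictly below all other copies.\<close>

lemma place_own:
  fixes s t :: real
  assumes "d > 0"
  shows "snd (place d i p) < slope d i s * fst (place d i p) + offset d i s t \<longleftrightarrow> snd p > s * fst p + t"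
    and "snd (place d i p) > slope d i s * fst (place d i p) + offset d i s t \<longleftrightarrow> snd p < s * fst p + t"
proof -
  have pos: "xscale d > 0" "yscale d > 0" using scales_pos[OF assms] by auto
  have *: "snd (place d i p) - (slope d i s * fst (place d i p) + offset d i s t) =
      yscale d * (s * fst p + t - snd p)"
    using pos by (simp add: place_def slope_def offset_def field_simps power2_eq_square)
  show "snd (place d i p) < slope d i s * fst (place d i p) + offset d i s t \<longleftrightarrow> snd p > s * fst p + t"
    using * pos mult_less_0_iff[of "yscale d" "s * fst p + t - snd p"] by linarith
  show "snd (place d i p) > slope d i s * fst (place d i p) + offset d i s t \<longleftrightarrow> snd p < s * fst p + t"
    using * pos zero_less_mult_iff[of "yscale d" "s * fst p + t - snd p"] by linarith
qed

text \<open>With r = j - i, the parabola at j is r^2 above its tangent at i. The perturbations add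
  up to at most 3/8 |r| + 9/64, less than r^2 because |r| >= 1.\<close>

lemma place_other:
  fixes s t :: real
  assumes "d > 0" "i \<noteq> j" "\<bar>s\<bar> \<le> span d" "\<bar>t\<bar> \<le> span d" "\<bar>fst p\<bar> \<le> span d" "\<bar>snd p\<bar> \<le> span d"
  shows "snd (place d j p) > slope d i s * fst (place d j p) + offset d i s t"
proof -
  define r where "r = real j - real i"
  define u where "u = xscale d * fst p"
  define w where "w = yscale d * s / xscale d"
  have r: "\<bar>r\<bar> \<ge> 1" using assms(2) by (auto simp: r_def)
  have u: "\<bar>u\<bar> \<le> 1/8" unfolding u_def by (rule scale_bounds[OF assms(1,5)])
  have w: "\<bar>w\<bar> \<le> 1/8" unfolding w_def by (rule scale_bounds[OF assms(1,3)])
  note yt = scale_bounds(2)[OF assms(1,4)] scale_bounds(2)[OF assms(1,6)]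
  have eq: "snd (place d j p) - (slope d i s * fst (place d j p) + offset d i s t) =
      r * r + 2 * (r * u) - yscale d * snd p + w * r + w * u + yscale d * t"
    unfolding place_def slope_def offset_def w_def[symmetric] u_def[symmetric] r_def
    by (simp add: algebra_simps power2_eq_square)
  have "\<bar>r * u\<bar> \<le> \<bar>r\<bar> * (1/8)" unfolding abs_mult using u by (intro mult_left_mono) auto
  moreover have "\<bar>w * r\<bar> \<le> (1/8) * \<bar>r\<bar>" unfolding abs_mult using w by (intro mult_right_mono) auto
  moreover have "\<bar>w * u\<bar> \<le> 1/8 * (1/8)" unfolding abs_mult using u w by (intro mult_mono) auto
  moreover have "1 * \<bar>r\<bar> \<le> \<bar>r\<bar> * \<bar>r\<bar>" using r by (intro mult_right_mono) auto
  then have "\<bar>r\<bar> \<le> r * r" by simp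
  ultimately have "r * r + 2 * (r * u) - yscale d * snd p + w * r + w * u + yscale d * t > 0"
    using yt r by linarith
  then show ?thesis using eq by linarith
qed

lemma slope_offset_bounds:
  fixes s t :: real
  assumes "i < d" "\<bar>s\<bar> \<le> span d" "\<bar>t\<bar> \<le> span d"
  shows "\<bar>slope d i s\<bar> \<le> span d" "\<bar>offset d i s t\<bar> \<le> span d"
proof -
  have d: "d > 0" using assms by simp
  define w where "w = yscale d * s / xscale d"
  have w: "\<bar>w\<bar> \<le> 1/8" unfolding w_def by (rule scale_bounds[OF d assms(2)])
  have "\<bar>w * real i\<bar> \<le> 1/8 * real i" 
    unfolding abs_mult abs_of_nat using w by (intro mult_right_mono) auto
  then show "\<bar>slope d i s\<bar> \<le> span d" "\<bar>offset d i s t\<bar> \<le> span d"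
    unfolding slope_def offset_def w_def[symmetric]
    using w scale_bounds(2)[OF d assms(3)] span_absorbs[OF assms(1)] zero_le_power2[of "real i"]
    by linarith+
qed

text \<open>The line of the subinstance is carried into copy \<open>i\<close>, where the flip puts
  the array entry above it and the pointer holder's points below. The bounds on \<open>s\<close> and
  \<open>t\<close> belong to the induction because \<open>place_other\<close> needs them.\<close>

lemma separating_line:
  assumes "d > 0" "a \<in> arrs d k" "b \<in> idxs d k" "jump k a b"
  shows "\<exists>s t. \<bar>s\<bar> \<le> span d \<and> \<bar>t\<bar> \<le> span d \<and>
           (\<forall>p\<in>upts d k a. snd p > s * fst p + t) \<and> (\<forall>p\<in>lpts d k b. snd p < s * fst p + t)"
  using assms(2-)
proof (induction k arbitrary: a b)
  case 0
  \<comment> \<open>The horizontal line halfway between (0, 0) and (0, -1).\<close>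
  then show ?case using span_ge_2[OF assms(1)] by (intro exI[of _ 0] exI[of _ "-1/2"]) auto
next
  case (Suc k)
  obtain l where l: "a = Arr l" "set l \<subseteq> idxs d k" "length l = d" using Suc.prems by auto
  obtain i x where i: "b = Idx i x" "i < d" "x \<in> arrs d k" using Suc.prems by auto
  have nth: "l ! j \<in> idxs d k" if "j < d" for j using l that nth_mem by blast
  have "jump k x (l ! i)" using Suc.prems l i by simp
  with Suc.IH[OF i(3) nth[OF i(2)]] obtain s t where st: "\<bar>s\<bar> \<le> span d" "\<bar>t\<bar> \<le> span d"
    "\<forall>p\<in>upts d k x. snd p > s * fst p + t" "\<forall>p\<in>lpts d k (l ! i). snd p < s * fst p + t" by blast
  let ?s = "slope d i s" and ?t = "offset d i s t"
  have "snd (place d j p) > ?s * fst (place d j p) + ?t" if j: "j < d" "p \<in> lpts d k (l ! j)" for j p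
  proof (cases "j = i")
    case True
    then show ?thesis using place_own(2)[OF assms(1)] st(4) j by blast
  next
    case False
    have "p \<in> pts d k" using upts_lpts_subset nth j by blast
    with pts_bounded[OF assms(1)] show ?thesis
      using place_other[OF assms(1) False[symmetric] st(1,2)] by blast
  qed
  then have "\<forall>p\<in>upts d (Suc k) a. snd p > ?s * fst p + ?t" using l(1) by auto
  moreover have "\<forall>p\<in>lpts d (Suc k) b. snd p < ?s * fst p + ?t"
    using place_own(1)[OF assms(1)] st(3) i(1) by auto
  ultimately show ?case using slope_offset_bounds[OF i(2) st(1,2)]
    by (intro exI[of _ ?s] exI[of _ ?t] conjI)
qed

lemma realizable_iff_jump:
  assumes "d > 0" "a \<in> arrs d k" "b \<in> idxs d k"
    and "set Sa = (\<lambda>p. (p, True)) ` upts d k a" "set Sb = (\<lambda>p. (p, False)) ` lpts d k b"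
  shows "realizable (Sa @ Sb) \<longleftrightarrow> jump k a b"
proof
  assume "realizable (Sa @ Sb)"
  then obtain w c where wc: "\<forall>(x, y) \<in> set (Sa @ Sb). halfplane w c x = y" by (auto simp: realizable_def)
  show "jump k a b"
  proof (rule ccontr)
    assume "\<not> jump k a b"
    then obtain p where "p \<in> upts d k a" "p \<in> lpts d k b" using common_point assms(2,3) by blast
    then have "(p, True) \<in> set (Sa @ Sb)" "(p, False) \<in> set (Sa @ Sb)" using assms(4,5) by auto
    from bspec[OF wc this(1)] bspec[OF wc this(2)] show False by simp
  qed
next
  assume "jump k a b"
  then obtain s t where st: "\<forall>p\<in>upts d k a. snd p > s * fst p + t" "\<forall>p\<in>lpts d k b. snd p < s * fst p + t"
    using separating_line assms(1-3) by blast
  have "\<forall>(x, y) \<in> set (Sa @ Sb). halfplane (- s, 1) t x = y"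
    using st assms(4,5) by (force simp: halfplane_def)
  then show "realizable (Sa @ Sb)" unfolding realizable_def by blast
qed

section \<open>From protocols to rectangle partitions\<close>

lemma run_stable:
  assumes "turn P (run P Sa Sb t) = None" "t \<le> u"
  shows "run P Sa Sb u = run P Sa Sb t"
  using assms(2) by (induction u rule: dec_induct) (use assms(1) in \<open>auto simp: Let_def\<close>)

lemma transcript_eq_run:
  assumes "turn P (run P Sa Sb t) = None"
  shows "transcript P Sa Sb = run P Sa Sb t"
proof -
  define L where "L = (LEAST k. turn P (run P Sa Sb k) = None)"
  have "turn P (run P Sa Sb L) = None" "L \<le> t"
    unfolding L_def using assms by (rule LeastI, rule Least_le)
  then show ?thesis using run_stable unfolding transcript_def L_def[symmetric] by metis
qed

lemma length_run:
  assumes "\<And>j. j < t \<Longrightarrow> turn P (run P Sa Sb j) \<noteq> None"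
  shows "length (run P Sa Sb t) = t"
  using assms by (induction t) (auto simp: Let_def split: option.split bool.split)

lemma length_transcript_gt:
  assumes "halts P Sa Sb" "turn P (run P Sa Sb t) \<noteq> None"
  shows "t < length (transcript P Sa Sb)"
proof -
  define L where "L = (LEAST k. turn P (run P Sa Sb k) = None)"
  have L: "turn P (run P Sa Sb L) = None"
    using assms(1) unfolding halts_def L_def by (rule LeastI_ex)
  then have "t < L" using run_stable[OF L, of t] assms(2) by (metis not_le)
  moreover have "length (run P Sa Sb L) = L"
    by (rule length_run) (use not_less_Least L_def in blast)
  ultimately show ?thesis by (simp add: transcript_def L_def)
qed

lemma finite_card_messages:
  assumes "finite E" "X \<subseteq> Ex ` E \<union> range Bit"
  shows "finite X \<and> card X \<le> card E + 2"
proof -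
  have *: "range Bit = {Bit True, Bit False}" by (auto simp: UNIV_bool)
  have fin: "finite (Ex ` E \<union> range Bit)" using assms(1) * by simp
  have "card (Ex ` E \<union> range Bit) \<le> card (Ex ` E) + card (range Bit)" by (rule card_Un_le)
  also have "\<dots> \<le> card E + 2" using card_image_le[OF assms(1), of Ex] * by simp
  finally show ?thesis using finite_subset[OF assms(2) fin] card_mono[OF fin assms(2)] by linarith
qed

text \<open>All pairs of the rectangle share the transcript \<open>h\<close> after \<open>t\<close>
  steps, and at most \<open>T\<close> units remain. So the next speaker is fixed and the message
  depends on one input alone, whence each fibre is again a rectangle.\<close>

lemma protocol_solv:
  assumes "finite E" "card E + 2 \<le> M"
    and "\<And>a. a \<in> A \<Longrightarrow> set (\<sigma> a) \<subseteq> E" "\<And>b. b \<in> B \<Longrightarrow> set (\<tau> b) \<subseteq> E"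
    and "\<And>a b. a \<in> A \<Longrightarrow> b \<in> B \<Longrightarrow> halts P (\<sigma> a) (\<tau> b) \<and> valid_run P (\<sigma> a) (\<tau> b) \<and>
           out P (transcript P (\<sigma> a) (\<tau> b)) = f a b \<and> length (transcript P (\<sigma> a) (\<tau> b)) \<le> t + T \<and>
           run P (\<sigma> a) (\<tau> b) t = h"
  shows "solv M T A B f"
  using assms(3-)
proof (induction T arbitrary: A B t h)
  case 0
  show ?case
  proof (rule solv_const)
    fix a b assume "a \<in> A" "b \<in> B"
    note * = 0(3)[OF this]
    then have "turn P (run P (\<sigma> a) (\<tau> b) t) = None" using length_transcript_gt by fastforce
    then show "f a b = out P h" using transcript_eq_run * by metis
  qed (use assms(2) in simp)
next
  case (Suc T)
  note prem = Suc.prems(3)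
  show ?case
  proof (cases "A = {} \<or> B = {} \<or> turn P h = None")
    case True
    show ?thesis
    proof (rule solv_const)
      fix a b assume "a \<in> A" "b \<in> B"
      with True prem show "f a b = out P h" by (metis empty_iff transcript_eq_run)
    qed (use assms(2) in simp)
  next
    case False
    \<comment> \<open>\<open>valid_run\<close> concerns pairs of inputs, so bounding one player's
      messages takes some input of the other.\<close>
    then obtain a0 b0 where 0: "a0 \<in> A" "b0 \<in> B" by blast
    from False consider "turn P h = Some True" | "turn P h = Some False" by (metis (full_types) option.exhaust)
    then show ?thesis
    proof cases
      case 1
      define g where "g = (\<lambda>a. alice P (\<sigma> a) h)"
      have "g a \<in> Ex ` E \<union> range Bit" if a: "a \<in> A" for a
      proof (cases "g a")
        case (Ex e)
        have "e \<in> set (\<sigma> a)" using prem[OF a 0(2)] 1 Ex unfolding valid_run_def g_def by metis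
        then show ?thesis using Ex Suc.prems(1) a by auto
      qed auto
      then have g: "finite (g ` A) \<and> card (g ` A) \<le> card E + 2"
        by (intro finite_card_messages assms(1)) auto
      have "solv M T {a \<in> A. g a = m} B f" for m
      proof (rule Suc.IH[of _ _ "Suc t" "h @ [m]"])
        fix a b assume ab: "a \<in> {a \<in> A. g a = m}" "b \<in> B"
        with prem[of a b] 1 show "halts P (\<sigma> a) (\<tau> b) \<and> valid_run P (\<sigma> a) (\<tau> b) \<and>
           out P (transcript P (\<sigma> a) (\<tau> b)) = f a b \<and> length (transcript P (\<sigma> a) (\<tau> b)) \<le> Suc t + T \<and>
           run P (\<sigma> a) (\<tau> b) (Suc t) = h @ [m]" by (simp add: g_def Let_def)
      qed (use Suc.prems in auto)
      then show ?thesis using g assms(2) unfolding solv.simps by (intro disjI1 exI[of _ g]) simp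
    next
      case 2
      define g where "g = (\<lambda>b. bob P (\<tau> b) h)"
      have "g b \<in> Ex ` E \<union> range Bit" if b: "b \<in> B" for b
      proof (cases "g b")
        case (Ex e)
        have "e \<in> set (\<tau> b)" using prem[OF 0(1) b] 2 Ex unfolding valid_run_def g_def by metis
        then show ?thesis using Ex Suc.prems(2) b by auto
      qed auto
      then have g: "finite (g ` B) \<and> card (g ` B) \<le> card E + 2"
        by (intro finite_card_messages assms(1)) auto
      have "solv M T A {b \<in> B. g b = m} f" for m
      proof (rule Suc.IH[of _ _ "Suc t" "h @ [m]"])
        fix a b assume ab: "a \<in> A" "b \<in> {b \<in> B. g b = m}"
        with prem[of a b] 2 show "halts P (\<sigma> a) (\<tau> b) \<and> valid_run P (\<sigma> a) (\<tau> b) \<and>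
           out P (transcript P (\<sigma> a) (\<tau> b)) = f a b \<and> length (transcript P (\<sigma> a) (\<tau> b)) \<le> Suc t + T \<and>
           run P (\<sigma> a) (\<tau> b) (Suc t) = h @ [m]" by (simp add: g_def Let_def)
      qed (use Suc.prems in auto)
      then show ?thesis using g assms(2) unfolding solv.simps by (intro disjI2 exI[of _ g]) simp
    qed
  qed
qed

text \<open>Repeating an example pads a sample to the prescribed length without affecting
  realizability.\<close>

lemma ex_list_set_length:
  assumes "finite S" "S \<noteq> {}" "card S \<le> N"
  shows "\<exists>xs. set xs = S \<and> length xs = N"
proof -
  obtain xs where xs: "set xs = S" "distinct xs" using finite_distinct_list[OF assms(1)] by blast
  obtain x where "x \<in> S" using assms(2) by blast
  then have "set (xs @ replicate (N - card S) x) = S" using xs by auto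
  moreover have "length (xs @ replicate (N - card S) x) = N"
    using xs assms(3) distinct_card[OF xs(2)] by simp
  ultimately show ?thesis by blast
qed

text \<open>Each half of the sample has to hold up to \<open>2 * d ^ (3 * T)\<close> points. With
  both labels these give at most \<open>n\<close> examples, and with the two bits at most
  \<open>n + 2\<close> messages.\<close>

lemma (in round_elimination) long_transcript:
  assumes P: "decides_realizability P" and n: "4 * d ^ (3 * T) \<le> n" "n + 2 \<le> M"
  shows "\<exists>Sa Sb. length Sa + length Sb = n \<and> T < length (transcript P Sa Sb)"
proof (rule ccontr)
  assume "\<not> ?thesis"
  then have short: "length (transcript P Sa Sb) \<le> T" if "length Sa + length Sb = n" for Sa Sb
    using that not_le by blast
  let ?k = "3 * T"
  have d0: "d > 0" using d m_pos by simp
  have fp: "finite (pts d ?k)" and cp: "card (pts d ?k) \<le> 2 * d ^ ?k" using card_pts by auto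
  have half: "2 * d ^ ?k \<le> n div 2" "2 * d ^ ?k \<le> n - n div 2" using n(1) by linarith+
  have "\<exists>S. set S = (\<lambda>p. (p, True)) ` upts d ?k a \<and> length S = n div 2" if "a \<in> arrs d ?k" for a
  proof (rule ex_list_set_length)
    have sub: "upts d ?k a \<subseteq> pts d ?k" using upts_lpts_subset that by blast
    show "finite ((\<lambda>p. (p, True)) ` upts d ?k a)" using finite_subset[OF sub fp] by simp
    show "(\<lambda>p. (p, True)) ` upts d ?k a \<noteq> {}" using upts_lpts_nonempty[OF d0] that by blast
    show "card ((\<lambda>p. (p, True)) ` upts d ?k a) \<le> n div 2"
      using card_image_le[OF finite_subset[OF sub fp], of "\<lambda>p. (p, True)"] card_mono[OF fp sub] cp half
      by linarith
  qed
  then obtain \<sigma> where \<sigma>: "\<And>a. a \<in> arrs d ?k \<Longrightarrow> set (\<sigma> a) = (\<lambda>p. (p, True)) ` upts d ?k a"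
      "\<And>a. a \<in> arrs d ?k \<Longrightarrow> length (\<sigma> a) = n div 2" by metis
  have "\<exists>S. set S = (\<lambda>p. (p, False)) ` lpts d ?k b \<and> length S = n - n div 2" if "b \<in> idxs d ?k" for b
  proof (rule ex_list_set_length)
    have sub: "lpts d ?k b \<subseteq> pts d ?k" using upts_lpts_subset that by blast
    show "finite ((\<lambda>p. (p, False)) ` lpts d ?k b)" using finite_subset[OF sub fp] by simp
    show "(\<lambda>p. (p, False)) ` lpts d ?k b \<noteq> {}" using upts_lpts_nonempty[OF d0] that by blast
    show "card ((\<lambda>p. (p, False)) ` lpts d ?k b) \<le> n - n div 2"
      using card_image_le[OF finite_subset[OF sub fp], of "\<lambda>p. (p, False)"] card_mono[OF fp sub] cp half
      by linarith
  qed
  then obtain \<tau> where \<tau>: "\<And>b. b \<in> idxs d ?k \<Longrightarrow> set (\<tau> b) = (\<lambda>p. (p, False)) ` lpts d ?k b"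
      "\<And>b. b \<in> idxs d ?k \<Longrightarrow> length (\<tau> b) = n - n div 2" by metis
  define E where "E = pts d ?k \<times> (UNIV :: bool set)"
  have "solv M T (arrs d ?k) (idxs d ?k) (jump ?k)"
  proof (rule protocol_solv[where E = E and \<sigma> = \<sigma> and \<tau> = \<tau> and t = 0 and h = "[]"])
    show "finite E" using fp by (simp add: E_def)
    have "card E = card (pts d ?k) * 2" by (simp add: E_def card_cartesian_product)
    then show "card E + 2 \<le> M" using cp n by linarith
    show "set (\<sigma> a) \<subseteq> E" if "a \<in> arrs d ?k" for a
    proof -
      have "upts d ?k a \<subseteq> pts d ?k" using upts_lpts_subset that by blast
      then show ?thesis using \<sigma>(1)[OF that] by (auto simp: E_def)
    qed
    show "set (\<tau> b) \<subseteq> E" if "b \<in> idxs d ?k" for b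
    proof -
      have "lpts d ?k b \<subseteq> pts d ?k" using upts_lpts_subset that by blast
      then show ?thesis using \<tau>(1)[OF that] by (auto simp: E_def)
    qed
    fix a b assume ab: "a \<in> arrs d ?k" "b \<in> idxs d ?k"
    have "realizable (\<sigma> a @ \<tau> b) = jump ?k a b"
      using realizable_iff_jump[OF d0 ab \<sigma>(1)[OF ab(1)] \<tau>(1)[OF ab(2)]] .
    moreover have "length (\<sigma> a) + length (\<tau> b) = n" using \<sigma>(2) \<tau>(2) ab by simp
    ultimately show "halts P (\<sigma> a) (\<tau> b) \<and> valid_run P (\<sigma> a) (\<tau> b) \<and>
           out P (transcript P (\<sigma> a) (\<tau> b)) = jump ?k a b \<and> length (transcript P (\<sigma> a) (\<tau> b)) \<le> 0 + T \<and>
           run P (\<sigma> a) (\<tau> b) 0 = []"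
      using P short unfolding decides_realizability_def by simp
  qed
  then show False using not_solv_jump by blast
qed

section \<open>Choice of parameters\<close>

text \<open>As 3/4 <= exp(-1/4), an exponent of at least 8 ln n brings the power down to n^(-2), and
  16 (n + 2) < n^2 once n >= 19.\<close>

lemma power_three_quarters_less:
  fixes n :: nat
  assumes "n \<ge> 19"
  shows "16 * real (n + 2) * (3/4) ^ nat \<lceil>8 * ln (real n)\<rceil> < 1"
proof -
  define m where "m = nat \<lceil>8 * ln (real n)\<rceil>"
  have n: "real n \<ge> 19" using assms by simp
  have m: "8 * ln (real n) \<le> real m" unfolding m_def by linarith
  have "(3/4 :: real) \<le> exp (- (1/4))" using exp_ge_add_one_self[of "- (1/4) :: real"] by simp
  then have "(3/4 :: real) ^ m \<le> exp (- (1/4)) ^ m" by (intro power_mono) auto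
  also have "\<dots> = exp (- (real m / 4))" by (simp add: exp_of_nat_mult[symmetric])
  also have "\<dots> \<le> exp (- (2 * ln (real n)))" using m by simp
  also have "\<dots> = 1 / (real n)\<^sup>2" using n by (simp add: exp_minus exp_double inverse_eq_divide)
  finally have "16 * real (n + 2) * (3/4) ^ m \<le> 16 * real (n + 2) * (1 / (real n)\<^sup>2)"
    by (intro mult_left_mono) auto
  also have "\<dots> < 1"
  proof -
    have "19 * real n \<le> real n * real n" using n by (intro mult_right_mono) auto
    then have "32 + 16 * real n < real n * real n" using n by linarith
    then show ?thesis using n by (simp add: divide_simps power2_eq_square)
  qed
  finally show ?thesis by (simp add: m_def)
qed

lemma sample_complexity_ge:
  assumes P: "decides_realizability P" and n: "n \<ge> 19"
    and d: "d = 32 * nat \<lceil>8 * ln (real n)\<rceil>"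
  shows "ereal (ln (real n / 4) / (3 * ln (real d))) \<le> ereal_of_enat (sample_complexity P n)"
proof -
  define m where "m = nat \<lceil>8 * ln (real n)\<rceil>"
  interpret round_elimination d m "n + 2"
    by unfold_locales (use d m_def power_three_quarters_less[OF n] n in auto)
  define z where "z = ln (real n / 4) / (3 * ln (real d))"
  \<comment> \<open>Rounding down ensures \<open>4 * d ^ (3 * T)\<close> <= \<open>n\<close>, yet a
    transcript longer than \<open>T\<close> still has length at least \<open>z\<close>.\<close>
  define T where "T = nat \<lfloor>z\<rfloor>"
  have d32: "real d \<ge> 32" using d m_pos by (simp add: m_def)
  then have ld: "ln (real d) > 0" by simp
  have z: "z \<ge> 0" using ld n by (simp add: z_def)
  have "real T \<le> z" using z by (simp add: T_def)
  then have "real T * (3 * ln (real d)) \<le> ln (real n / 4)" using ld by (simp add: z_def field_simps)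
  then have "exp (real (3 * T) * ln (real d)) \<le> exp (ln (real n / 4))" by (simp add: mult_ac)
  then have "real d ^ (3 * T) \<le> real n / 4" using d32 n by (simp only: exp_of_nat_mult) simp
  then have "real (4 * d ^ (3 * T)) \<le> real n" by simp
  then have "4 * d ^ (3 * T) \<le> n" by linarith
  then obtain Sa Sb where S: "length Sa + length Sb = n" "T < length (transcript P Sa Sb)"
    using long_transcript[OF P _ order_refl] by blast
  have "enat (length (transcript P (fst (Sa, Sb)) (snd (Sa, Sb)))) \<le> sample_complexity P n"
    unfolding sample_complexity_def by (rule SUP_upper) (use S in auto)
  then have "ereal_of_enat (enat (length (transcript P Sa Sb))) \<le> ereal_of_enat (sample_complexity P n)"
    by (simp add: ereal_of_enat_le_iff del: ereal_of_enat_simps)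
  moreover have "z \<le> real (length (transcript P Sa Sb))" using S(2) unfolding T_def by linarith
  ultimately show ?thesis unfolding z_def[symmetric]
    by (metis ereal_less_eq(3) ereal_of_enat_simps(1) order_trans)
qed

theorem theorem8:
  fixes P :: protocol
  assumes "decides_realizability P"
  shows "\<exists>c > 0. \<exists>k :: nat. \<exists>N :: nat. \<forall>n \<ge> N.
           ereal (c * ln (real n) / (ln (ln (real n))) ^ k) \<le> ereal_of_enat (sample_complexity P n)"
proof -
  \<comment> \<open>The degree is at most 32 (8 ln n + 1), eventually below (ln n)^2.\<close>
  have "eventually (\<lambda>n::nat. ln (32 * (8 * ln (real n) + 1)) \<le> 2 * ln (ln (real n))) at_top"
    by real_asymp
  moreover have "eventually (\<lambda>n::nat. ln (real n) / 2 \<le> ln (real n / 4)) at_top" by real_asymp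
  moreover have "eventually (\<lambda>n::nat. ln (ln (real n)) > 0) at_top" by real_asymp
  moreover have "eventually (\<lambda>n::nat. n \<ge> 19) at_top" by (rule eventually_ge_at_top)
  ultimately have "eventually (\<lambda>n. ereal (1/12 * ln (real n) / (ln (ln (real n))) ^ 1)
      \<le> ereal_of_enat (sample_complexity P n)) at_top"
  proof eventually_elim
    case (elim n)
    define q where "q = nat \<lceil>8 * ln (real n)\<rceil>"
    define d where "d = 32 * q"
    have l: "ln (real n) > 0" using elim(4) by (intro ln_gt_zero) auto
    have "real q \<le> 8 * ln (real n) + 1" "q \<ge> 1" unfolding q_def using l by linarith+
    then have d: "real d \<le> 32 * (8 * ln (real n) + 1)" "real d \<ge> 32" by (auto simp: d_def)
    then have "ln (real d) \<le> ln (32 * (8 * ln (real n) + 1))" using l by (subst ln_le_cancel_iff) auto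
    then have ld: "ln (real d) \<le> 2 * ln (ln (real n))" "ln (real d) > 0" using elim(1) d(2) by auto
    \<comment> \<open>The constant combines 1/2 from ln (n / 4), three levels per round and the 2
      from the bound on ln d.\<close>
    have "1/12 * ln (real n) / ln (ln (real n)) = (ln (real n) / 2) / (3 * (2 * ln (ln (real n))))" by simp
    also have "\<dots> \<le> ln (real n / 4) / (3 * ln (real d))"
      using elim l ld by (intro frac_le) auto
    finally have "ereal (1/12 * ln (real n) / ln (ln (real n)))
        \<le> ereal (ln (real n / 4) / (3 * ln (real d)))" by simp
    also have "\<dots> \<le> ereal_of_enat (sample_complexity P n)"
      by (rule sample_complexity_ge[OF assms elim(4) d_def[unfolded q_def]])
    finally show ?case by simp
  qed
  then obtain N where "\<forall>n\<ge>N. ereal (1/12 * ln (real n) / (ln (ln (real n))) ^ 1)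
      \<le> ereal_of_enat (sample_complexity P n)" unfolding eventually_at_top_linorder by blast
  then show ?thesis by (intro exI[of _ "1/12"] conjI exI[of _ 1] exI[of _ N]) auto
qed

end
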